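(* Let $\Re(\tau_j)>\Re(\gamma_j)>0$ $(j=1,\dots,4)$. Then \begin{align*} &\mathcal{F}^{\mathbf{c}}\left[\begin{matrix}\alpha_1+\lambda_1,\beta_1:\alpha_2+\lambda_2,\beta_2\\ \tau_1:\tau_2\end{matrix};x_1,x_2,x_3,x_4\right] =\int_0^1\!\int_0^1\!\int_0^1\!\int_0^1(1-u_1x_1)^{-\lambda_1}(1-u_2x_2)^{-\lambda_2}\\ &\quad\cdot\mathcal{F}^{\mathbf{a}}\left[\begin{matrix}\alpha_1,\beta_1:\alpha_2,\beta_2\\ \gamma_1:\gamma_2\end{matrix};x_1u_1,x_2u_2,x_3u_3,x_4u_4\right]\\ &\quad\cdot\mathcal{F}^{\mathbf{b}}\left[\begin{matrix}\lambda_1,\beta_1-\gamma_1:\lambda_2,\beta_2-\gamma_2\\ \tau_1-\gamma_1:\tau_2-\gamma_2\end{matrix};\frac{(1-u_1)x_1}{1-u_1x_1},\frac{(1-u_2)x_2}{1-u_2x_2},\frac{u_3x_3}{1-u_1x_1},\frac{u_4x_4}{1-u_2x_2}\right]\prod_{j=1}^{4}\mathrm{d}\mu_{\gamma_j,\tau_j-\gamma_j}(u_j), \end{align*} where \[ \mathbf{c}(m,n)=\frac{(\gamma_3)_m}{(\tau_3)_m}\frac{(\gamma_4)_n}{(\tau_4)_n}(\mathbf{a}\star\mathbf{b})(m,n). \]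
   Context: $(a)_n=a(a+1)\cdots(a+n-1)$ is the Pochhammer symbol, and ${}_{2}F_{1}\left[\begin{matrix}\alpha,\beta\\ \gamma\end{matrix};z\right]=\sum_{n\ge0}\frac{(\alpha)_n(\beta)_n}{(\gamma)_n}\frac{z^n}{n!}$ $(|z|<1)$ is the Gauss hypergeometric function. $\mathbf{a}=a(m,n)$ and $\mathbf{b}=b(m,n)$ $(m,n\ge0)$ are double sequences, and their discrete convolution product is \[ (\mathbf{a}\star\mathbf{b})(m,n)=\sum_{i=0}^{m}\sum_{j=0}^{n}a(m-i,n-j)\,b(i,j). \] For a double sequence $\mathbf{a}$, define \[ \mathcal{F}^{\mathbf{a}}\left[\begin{matrix}\alpha_1,\beta_1:\alpha_2,\beta_2\\ \gamma_1:\gamma_2\end{matrix};x_1,x_2,x_3,x_4\right]:=\sum_{m,n=0}^{\infty}a(m,n)\,{}_{2}F_{1}\left[\begin{matrix}\alpha_1+m,\beta_1\\ \gamma_1\end{matrix};x_1\right]{}_{2}F_{1}\left[\begin{matrix}\alpha_2+n,\beta_2\\ \gamma_2\end{matrix};x_2\right]x_3^{m}x_4^{n}. \] For $\min\{\Re(\alpha),\Re(\beta)\}>0$, the Dirichlet measure on $(0,1)$ is $\mathrm{d}\mu_{\alpha,\beta}(t)=\frac{\Gamma(\alpha+\beta)}{\Gamma(\alpha)\Gamma(\beta)}t^{\alpha-1}(1-t)^{\beta-1}\mathrm{d}t$.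
   Formalization: The statement leaves convergence implicit; here the two double series in the integrand are assumed to converge absolutely on the open cube, and the integral to converge absolutely with all series terms replaced by their moduli (|x1|,|x2|<1). Convergence of the left side is then proved. *)

theory Defs
  imports "HOL-Analysis.Analysis"
begin

definition hyp2F1 :: "complex \<Rightarrow> complex \<Rightarrow> complex \<Rightarrow> complex \<Rightarrow> complex" where
  "hyp2F1 \<alpha> \<beta> \<gamma> z =
     (\<Sum>n. pochhammer \<alpha> n * pochhammer \<beta> n / pochhammer \<gamma> n * (z ^ n / fact n))"

definition dconv :: "(nat \<Rightarrow> nat \<Rightarrow> complex) \<Rightarrow> (nat \<Rightarrow> nat \<Rightarrow> complex) \<Rightarrow> nat \<Rightarrow> nat \<Rightarrow> complex"
    (infixl "\<star>" 70) where
  "(a \<star> b) m n = (\<Sum>i=0..m. \<Sum>j=0..n. a (m - i) (n - j) * b i j)"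

definition F_term :: "(nat \<Rightarrow> nat \<Rightarrow> complex) \<Rightarrow>
    complex \<Rightarrow> complex \<Rightarrow> complex \<Rightarrow> complex \<Rightarrow> complex \<Rightarrow> complex \<Rightarrow>
    complex \<Rightarrow> complex \<Rightarrow> complex \<Rightarrow> complex \<Rightarrow> nat \<times> nat \<Rightarrow> complex" where
  "F_term a \<alpha>1 \<beta>1 \<alpha>2 \<beta>2 \<gamma>1 \<gamma>2 x1 x2 x3 x4 = (\<lambda>(m, n).
     a m n * hyp2F1 (\<alpha>1 + of_nat m) \<beta>1 \<gamma>1 x1 * hyp2F1 (\<alpha>2 + of_nat n) \<beta>2 \<gamma>2 x2 * x3 ^ m * x4 ^ n)"

definition F_conv :: "(nat \<Rightarrow> nat \<Rightarrow> complex) \<Rightarrow>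
    complex \<Rightarrow> complex \<Rightarrow> complex \<Rightarrow> complex \<Rightarrow> complex \<Rightarrow> complex \<Rightarrow>
    complex \<Rightarrow> complex \<Rightarrow> complex \<Rightarrow> complex \<Rightarrow> bool" where
  "F_conv a \<alpha>1 \<beta>1 \<alpha>2 \<beta>2 \<gamma>1 \<gamma>2 x1 x2 x3 x4 \<longleftrightarrow>
     (\<lambda>p. norm (F_term a \<alpha>1 \<beta>1 \<alpha>2 \<beta>2 \<gamma>1 \<gamma>2 x1 x2 x3 x4 p)) summable_on UNIV"

text \<open>The parameters of \<open>F_sum a \<alpha>1 \<beta>1 \<alpha>2 \<beta>2 \<gamma>1 \<gamma>2 x1 x2 x3 x4\<close> are those of the array
  with top row \<open>\<alpha>1, \<beta>1 : \<alpha>2, \<beta>2\<close> and bottom row \<open>\<gamma>1 : \<gamma>2\<close>.\<close>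

definition F_sum :: "(nat \<Rightarrow> nat \<Rightarrow> complex) \<Rightarrow>
    complex \<Rightarrow> complex \<Rightarrow> complex \<Rightarrow> complex \<Rightarrow> complex \<Rightarrow> complex \<Rightarrow>
    complex \<Rightarrow> complex \<Rightarrow> complex \<Rightarrow> complex \<Rightarrow> complex" where
  "F_sum a \<alpha>1 \<beta>1 \<alpha>2 \<beta>2 \<gamma>1 \<gamma>2 x1 x2 x3 x4 =
     infsum (F_term a \<alpha>1 \<beta>1 \<alpha>2 \<beta>2 \<gamma>1 \<gamma>2 x1 x2 x3 x4) UNIV"

text \<open>The same double series with every term replaced by its modulus; it only serves to express
  absolute convergence.\<close>

definition F_abs :: "(nat \<Rightarrow> nat \<Rightarrow> complex) \<Rightarrow>
    complex \<Rightarrow> complex \<Rightarrow> complex \<Rightarrow> complex \<Rightarrow> complex \<Rightarrow> complex \<Rightarrow>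
    complex \<Rightarrow> complex \<Rightarrow> complex \<Rightarrow> complex \<Rightarrow> real" where
  "F_abs a \<alpha>1 \<beta>1 \<alpha>2 \<beta>2 \<gamma>1 \<gamma>2 x1 x2 x3 x4 =
     infsum (\<lambda>p. norm (F_term a \<alpha>1 \<beta>1 \<alpha>2 \<beta>2 \<gamma>1 \<gamma>2 x1 x2 x3 x4 p)) UNIV"

text \<open>For complex parameters the Dirichlet measure is a complex measure, so it is represented by
  its density with respect to Lebesgue measure on \<open>(0, 1)\<close>.\<close>

definition dirichlet_density :: "complex \<Rightarrow> complex \<Rightarrow> real \<Rightarrow> complex" where
  "dirichlet_density \<alpha> \<beta> t = Gamma (\<alpha> + \<beta>) / (Gamma \<alpha> * Gamma \<beta>) *
     of_real t powr (\<alpha> - 1) * of_real (1 - t) powr (\<beta> - 1)"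

definition unit_cube4 :: "(real \<times> real \<times> real \<times> real) set" where
  "unit_cube4 = {0<..<1} \<times> {0<..<1} \<times> {0<..<1} \<times> {0<..<1}"

end

theory Submission
  imports Defs "HOL-Complex_Analysis.Cauchy_Integral_Theorem"
begin

text \<open>Termwise, the identity is the product of two Erdelyi integrals
  \<open>F(\<alpha> + \<lambda>, \<beta>; \<tau>; x) =
      \<integral> (1 - u x) powr (-\<lambda>) F(\<alpha>, \<beta>; \<gamma>; x u) F(\<lambda>, \<beta> - \<gamma>; \<tau> - \<gamma>; (1 - u) x / (1 - u x)) d\<mu>(u)\<close>
  in \<open>u1\<close> and \<open>u2\<close> (with \<open>\<alpha> + k\<close> and \<open>\<lambda> + i\<close> in place of \<open>\<alpha>\<close> and \<open>\<lambda>\<close>) and two moments of the Dirichlet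
  measure in \<open>u3\<close> and \<open>u4\<close>. The result depends only on the total indices \<open>(k + i, l + j)\<close>, so
  grouping the absolutely convergent fourfold series by these produces the convolution \<open>a \<star> b\<close>.
  Erdelyi's integral is obtained in the same way: expanding its integrand gives a triple series of
  Dirichlet moments, which the Chu--Vandermonde identity collapses to the series on the left.\<close>

section \<open>Measurability, termwise integration and rearrangement of sums\<close>

lemma borel_measurable_complex_of_real [measurable (raw)]:
  "f \<in> borel_measurable M \<Longrightarrow> (\<lambda>x. complex_of_real (f x)) \<in> borel_measurable M"
  by (rule measurable_compose[OF _ borel_measurable_of_real])

text \<open>A complex power is in general discontinuous across the branch cut of the logarithm, so
  \<open>powr\<close> is unfolded into \<open>exp\<close> and \<open>ln\<close> instead of appealing
  to its continuity.\<close>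

lemma borel_measurable_powr_complex [measurable (raw)]:
  fixes a :: complex
  assumes [measurable]: "f \<in> borel_measurable M"
  shows "(\<lambda>x. f x powr a) \<in> borel_measurable M"
proof -
  have [measurable]: "exp \<in> borel_measurable (borel :: complex measure)"
    by (intro borel_measurable_continuous_onI continuous_intros)
  show ?thesis
    unfolding powr_def by measurable
qed

text \<open>Integrating \<open>bound\<close> over a finite set of indices bounds the partial sums of
  the L1 norms by the integral of \<open>w\<close>. These norms are therefore summable, which is
  what licenses exchanging sum and integral.\<close>

lemma
  fixes f :: "'i::countable \<Rightarrow> 'a \<Rightarrow> 'b::{banach,second_countable_topology}"
  assumes inf: "infinite (UNIV :: 'i set)"
    and int: "\<And>i. integrable M (f i)"
    and w: "integrable M w"
    and bound: "\<And>x F. finite F \<Longrightarrow> (\<Sum>i\<in>F. norm (f i x)) \<le> w x"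
  shows summable_on_integral_norm: "(\<lambda>i. \<integral>x. norm (f i x) \<partial>M) summable_on UNIV"
    and has_sum_integral: "((\<lambda>i. integral\<^sup>L M (f i)) has_sum (\<integral>x. (\<Sum>\<^sub>\<infinity>i. f i x) \<partial>M)) UNIV"
    and integrable_infsum: "integrable M (\<lambda>x. \<Sum>\<^sub>\<infinity>i. f i x)"
proof -
  let ?N = "\<lambda>i. \<integral>x. norm (f i x) \<partial>M"
  show sumN: "?N summable_on UNIV"
  proof (rule nonneg_bdd_above_summable_on)
    show "bdd_above (sum ?N ` {F. F \<subseteq> UNIV \<and> finite F})"
    proof (rule bdd_aboveI2)
      fix F :: "'i set" assume "F \<in> {F. F \<subseteq> UNIV \<and> finite F}"
      then have "sum ?N F = (\<integral>x. (\<Sum>i\<in>F. norm (f i x)) \<partial>M)"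
        using int by (subst Bochner_Integration.integral_sum) auto
      also have "\<dots> \<le> integral\<^sup>L M w"
        using \<open>F \<in> _\<close> int w bound by (intro integral_mono) auto
      finally show "sum ?N F \<le> integral\<^sup>L M w" .
    qed
  qed auto
  have sumx: "(\<lambda>i. norm (f i x)) summable_on UNIV" for x
    by (rule nonneg_bdd_above_summable_on) (auto intro!: bdd_aboveI2[where M = "w x"] bound)
  \<comment> \<open>Termwise integration is available for series over \<open>nat\<close>, so the
    index type is enumerated by a bijection; this is where \<open>inf\<close> enters.\<close>
  define g :: "nat \<Rightarrow> 'i" where "g = from_nat_into UNIV"
  have bij: "bij_betw g UNIV UNIV"
    unfolding g_def by (intro bij_betw_from_nat_into inf) auto
  have sumx': "summable (\<lambda>n. norm (f (g n) x))" for x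
    using sumx[of x] summable_on_reindex_bij_betw[OF bij, of "\<lambda>i. norm (f i x)"]
    by (simp add: summable_on_UNIV_nonneg_real_iff)
  have sumN': "summable (\<lambda>n. ?N (g n))"
    using sumN summable_on_reindex_bij_betw[OF bij, of ?N]
    by (simp add: summable_on_UNIV_nonneg_real_iff)
  have eq: "(\<Sum>n. f (g n) x) = (\<Sum>\<^sub>\<infinity>i. f i x)" for x
    using norm_summable_imp_has_sum[OF sumx' summable_sums[OF summable_norm_cancel[OF sumx']]]
      has_sum_reindex_bij_betw[OF bij, of "\<lambda>i. f i x"]
    by (metis infsumI)
  have "(\<lambda>n. integral\<^sup>L M (f (g n))) sums (\<integral>x. (\<Sum>n. f (g n) x) \<partial>M)"
    by (rule sums_integral[OF int _ sumN']) (simp add: sumx')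
  \<comment> \<open>Absolute summability makes the value independent of the enumeration, so
    \<open>sums\<close> can be turned into \<open>has_sum\<close>.\<close>
  moreover have "summable (\<lambda>n. norm (integral\<^sup>L M (f (g n))))"
    by (rule summable_comparison_test'[OF sumN', of 0]) (simp add: integral_norm_bound)
  ultimately have "((\<lambda>n. integral\<^sup>L M (f (g n))) has_sum (\<integral>x. (\<Sum>\<^sub>\<infinity>i. f i x) \<partial>M)) UNIV"
    unfolding eq by (intro norm_summable_imp_has_sum)
  then show "((\<lambda>i. integral\<^sup>L M (f i)) has_sum (\<integral>x. (\<Sum>\<^sub>\<infinity>i. f i x) \<partial>M)) UNIV"
    using has_sum_reindex_bij_betw[OF bij] by fastforce
  show "integrable M (\<lambda>x. \<Sum>\<^sub>\<infinity>i. f i x)"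
    using integrable_suminf[OF int _ sumN'] by (simp add: sumx' eq)
qed

text \<open>The index type is the disjoint union of the fibers of \<open>h\<close>. Summing fiber by
  fiber is legitimate for an unordered sum, and finiteness turns each inner sum into an ordinary
  one.\<close>

lemma has_sum_fibers:
  fixes f :: "'i \<Rightarrow> 'b::{topological_comm_monoid_add,t3_space}"
  assumes "(f has_sum S) UNIV" and "\<And>y. finite {i. h i = y}"
  shows "((\<lambda>y. \<Sum>i | h i = y. f i) has_sum S) UNIV"
proof -
  have bij: "bij_betw snd (SIGMA y:UNIV. {i. h i = y}) UNIV"
    by (rule bij_betwI[of _ _ _ "\<lambda>i. (h i, i)"]) auto
  have "((\<lambda>p. f (snd p)) has_sum S) (SIGMA y:UNIV. {i. h i = y})"
    using assms(1) has_sum_reindex_bij_betw[OF bij, of f] by simp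
  then show ?thesis
    by (rule has_sum_SigmaD) (use assms(2) in \<open>auto simp: has_sum_finite_iff\<close>)
qed

text \<open>The iterated sums are immediate. For summability on the product, a finite set is
  enclosed in the rectangle of its two projections, over which the sum of norms factors.\<close>

lemma has_sum_mult_Times:
  fixes f :: "'i \<Rightarrow> 'b::{real_normed_field,banach}"
  assumes "(\<lambda>i. norm (f i)) summable_on A" "(\<lambda>j. norm (g j)) summable_on B"
  shows "((\<lambda>(i, j). f i * g j) has_sum (infsum f A * infsum g B)) (A \<times> B)"
proof (rule has_sum_SigmaI)
  show "((\<lambda>y. case (i, y) of (i, j) \<Rightarrow> f i * g j) has_sum f i * infsum g B) B" for i
    using abs_summable_summable[OF assms(2)] by (auto intro!: has_sum_cmult_right)
  show "((\<lambda>i. f i * infsum g B) has_sum infsum f A * infsum g B) A"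
    using abs_summable_summable[OF assms(1)] by (auto intro!: has_sum_cmult_left)
  have "(\<lambda>p. norm ((\<lambda>(i, j). f i * g j) p)) summable_on A \<times> B"
  proof (rule nonneg_bdd_above_summable_on)
    show "bdd_above (sum (\<lambda>p. norm ((\<lambda>(i, j). f i * g j) p)) ` {F. F \<subseteq> A \<times> B \<and> finite F})"
    proof (rule bdd_aboveI2)
      fix F assume "F \<in> {F. F \<subseteq> A \<times> B \<and> finite F}"
      then have F: "F \<subseteq> A \<times> B" "finite F" by auto
      have "(\<Sum>p\<in>F. norm ((\<lambda>(i, j). f i * g j) p)) \<le>
          (\<Sum>p\<in>fst ` F \<times> snd ` F. norm ((\<lambda>(i, j). f i * g j) p))"
        using F by (intro sum_mono2) (auto simp: image_iff intro: rev_image_eqI)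
      also have "\<dots> = (\<Sum>i\<in>fst ` F. norm (f i)) * (\<Sum>j\<in>snd ` F. norm (g j))"
        by (simp add: sum_product sum.cartesian_product norm_mult case_prod_unfold)
      also have "\<dots> \<le> (\<Sum>\<^sub>\<infinity>i\<in>A. norm (f i)) * (\<Sum>\<^sub>\<infinity>j\<in>B. norm (g j))"
        using F assms by (intro mult_mono finite_sum_le_infsum sum_nonneg infsum_nonneg) auto
      finally show "(\<Sum>p\<in>F. norm ((\<lambda>(i, j). f i * g j) p)) \<le>
          (\<Sum>\<^sub>\<infinity>i\<in>A. norm (f i)) * (\<Sum>\<^sub>\<infinity>j\<in>B. norm (g j))" .
    qed
  qed auto
  then show "(\<lambda>(i, j). f i * g j) summable_on A \<times> B"
    by (rule abs_summable_summable)
qed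

section \<open>Gamma and Beta integrals, and the moments of the Dirichlet density\<close>

lemma not_nonpos_Ints_if_Re_pos: "Re z > 0 \<Longrightarrow> z \<notin> \<int>\<^sub>\<le>\<^sub>0"
  by (auto elim!: nonpos_Ints_cases)

text \<open>Euler's integral is moved from the gauge integral to \<open>lborel\<close>, with the
  domain expressed by an indicator, so that translations and Fubini apply to it.\<close>

lemma
  assumes "Re z > 0"
  shows integrable_Gamma_complex:
      "integrable lborel (\<lambda>t. indicator {0<..} t * (of_real t powr (z - 1) / of_real (exp t)))"
    and integral_Gamma_complex:
      "(\<integral>t. indicator {0<..} t * (of_real t powr (z - 1) / of_real (exp t)) \<partial>lborel) = Gamma z"
proof -
  let ?f = "\<lambda>t. complex_of_real t powr (z - 1) / of_real (exp t)"
  have eq: "(\<lambda>t. indicator {0<..} t * ?f t) = (\<lambda>t. indicator {0<..} t *\<^sub>R ?f t)"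
    by (auto simp: indicator_def)
  have "set_integrable lebesgue {0<..} ?f"
    using absolutely_integrable_Gamma_integral'[OF assms] .
  then have int: "set_integrable lborel {0<..} ?f"
    unfolding set_integrable_def by (subst (asm) integrable_completion) auto
  then show "integrable lborel (\<lambda>t. indicator {0<..} t * ?f t)"
    unfolding eq set_integrable_def .
  have "set_lebesgue_integral lborel {0<..} ?f = integral {0<..} ?f"
    using int by (rule set_borel_integral_eq_integral)
  then show "(\<integral>t. indicator {0<..} t * ?f t \<partial>lborel) = Gamma z"
    using Gamma_integral_complex'[OF assms]
    unfolding eq set_lebesgue_integral_def by (simp add: integral_unique)
qed

text \<open>Integrate \<open>G a t * G b (v - t)\<close> in both orders, where \<open>G\<close> is the integrand of Euler's
  integral for \<open>Gamma\<close>.\<close>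

lemma
  assumes a: "Re a > 0" and b: "Re b > 0"
  shows integrable_Beta_complex:
      "integrable lborel (\<lambda>t. indicator {0<..<1} t * (of_real t powr (a - 1) * of_real (1 - t) powr (b - 1)))"
    and integral_Beta_complex:
      "(\<integral>t. indicator {0<..<1} t * (of_real t powr (a - 1) * of_real (1 - t) powr (b - 1)) \<partial>lborel)
         = Beta a b"
proof -
  let ?B = "\<lambda>t. indicator {0<..<1} t * (complex_of_real t powr (a - 1) * of_real (1 - t) powr (b - 1))"
  define G where "G z t = indicator {0<..} t * (of_real t powr (z - 1) / of_real (exp t))"
    for z :: complex and t :: real
  have G_meas[measurable]: "G z \<in> borel_measurable borel" for z
    unfolding G_def by measurable
  have G_int: "integrable lborel (G z)" and G_val: "integral\<^sup>L lborel (G z) = Gamma z"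
    if "Re z > 0" for z
    using integrable_Gamma_complex[OF that] integral_Gamma_complex[OF that]
        by (simp_all add: G_def[abs_def])
  \<comment> \<open>The real Beta integrand for \<open>Re a\<close> and \<open>Re b\<close> is the
    modulus of the complex one.\<close>
  have "integrable lborel (\<lambda>t. indicator {0..1} t *\<^sub>R (t powr (Re a - 1) * (1 - t) powr (Re b - 1)))"
    using integrable_Beta[OF a b] by (simp add: set_integrable_def)
  then show "integrable lborel ?B"
    by (rule Bochner_Integration.integrable_bound)
       (auto simp: indicator_def norm_mult norm_powr_real_powr)
  have shift: "integrable lborel (\<lambda>v. G b (v - t))" "(\<integral>v. G b (v - t) \<partial>lborel) = Gamma b" for t
    using lborel_integrable_real_affine[OF G_int[OF b], of 1 "-t"]
      lborel_integral_real_affine[of 1 "G b" "-t"] G_val[OF b] by simp_all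
  have shift_norm: "(\<integral>v. norm (G b (v - t)) \<partial>lborel) = (\<integral>v. norm (G b v) \<partial>lborel)" for t
    using lborel_integral_real_affine[of 1 "\<lambda>v. norm (G b v)" "-t"] by simp
  have "integrable (lborel \<Otimes>\<^sub>M lborel) (\<lambda>(t, v). G a t * G b (v - t))"
  proof (rule lborel_pair.Fubini_integrable)
    show "integrable lborel (\<lambda>t. \<integral>v. norm (case (t, v) of (t, v) \<Rightarrow> G a t * G b (v - t)) \<partial>lborel)"
      using G_int[OF a] by (simp add: norm_mult shift_norm)
    show "AE t in lborel. integrable lborel (\<lambda>v. case (t, v) of (t, v) \<Rightarrow> G a t * G b (v - t))"
      using shift by simp
  qed measurable
  then have "(\<integral>v. (\<integral>t. G a t * G b (v - t) \<partial>lborel) \<partial>lborel) =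
      (\<integral>t. (\<integral>v. G a t * G b (v - t) \<partial>lborel) \<partial>lborel)"
    by (rule lborel_pair.Fubini_integral)
  also have "\<dots> = Gamma a * Gamma b"
    by (simp add: shift G_val a)
  \<comment> \<open>For \<open>v > 0\<close>, replacing \<open>t\<close> by \<open>v * t\<close>
    separates the variables: the Jacobian \<open>v\<close> and the two powers of \<open>v\<close>
    combine to the exponent \<open>a + b - 1\<close>, and the exponentials multiply to
    \<open>exp v\<close>. For \<open>v \<le> 0\<close> the supports of the two factors are
    disjoint.\<close>
  also have "(\<lambda>v. \<integral>t. G a t * G b (v - t) \<partial>lborel) = (\<lambda>v. G (a + b) v * integral\<^sup>L lborel ?B)"
  proof
    fix v :: real
    show "(\<integral>t. G a t * G b (v - t) \<partial>lborel) = G (a + b) v * integral\<^sup>L lborel ?B"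
    proof (cases "v > 0")
      case True
      have *: "v *\<^sub>R (G a (v * t) * G b (v - v * t)) = G (a + b) v * ?B t" for t
      proof (cases "t \<in> {0<..<1}")
        case t: True
        have "complex_of_real (v * t) powr (a - 1) = of_real v powr (a - 1) * of_real t powr (a - 1)"
          using True t by (simp add: powr_times_real)
        moreover have "complex_of_real (v - v * t) powr (b - 1) =
            of_real v powr (b - 1) * of_real (1 - t) powr (b - 1)"
          using True t powr_times_real[of "of_real v" "of_real (1 - t)" "b - 1"] 
          by (simp add: algebra_simps)
        moreover have "complex_of_real v powr (a + b - 1) =
            of_real v * (of_real v powr (a - 1) * of_real v powr (b - 1))"
        proof -
          have "complex_of_real v powr (a + b - 1) = of_real v powr (1 + ((a - 1) + (b - 1)))"
            by (simp add: algebra_simps)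
          then show ?thesis
            using True by (simp only: powr_add) simp
        qed
        moreover have "exp (v * t) * exp (v - v * t) = exp v"
          by (simp add: exp_add[symmetric])
        then have "complex_of_real (exp (v * t)) * of_real (exp (v - v * t)) = of_real (exp v)"
          by (metis of_real_mult)
        ultimately show ?thesis
          using True t by (simp add: G_def scaleR_conv_of_real field_simps)
      qed (use True in \<open>auto simp: G_def indicator_def zero_less_mult_iff not_less mult_le_cancel_left1\<close>)
      have "(\<integral>t. G a t * G b (v - t) \<partial>lborel) = (\<integral>t. v *\<^sub>R (G a (v * t) * G b (v - v * t)) \<partial>lborel)"
        using True lborel_integral_real_affine[of v "\<lambda>t. G a t * G b (v - t)" 0] by simp
      also have "\<dots> = G (a + b) v * integral\<^sup>L lborel ?B"
        unfolding * by simp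
      finally show ?thesis .
    next
      case False
      then have "(\<lambda>t. G a t * G b (v - t)) = (\<lambda>_. 0)"
        by (auto simp: G_def indicator_def)
      with False show ?thesis by (simp add: G_def)
    qed
  qed
  finally have "Gamma (a + b) * integral\<^sup>L lborel ?B = Gamma a * Gamma b"
    using a b by (simp add: G_val)
  moreover have "Gamma (a + b) \<noteq> 0"
    using not_nonpos_Ints_if_Re_pos[of "a + b"] a b by (simp add: Gamma_eq_zero_iff)
  ultimately show "integral\<^sup>L lborel ?B = Beta a b"
    by (simp add: Beta_def field_simps)
qed

lemma Gamma_plus_of_nat:
  fixes z :: complex
  assumes "Re z > 0"
  shows "Gamma (z + of_nat n) = pochhammer z n * Gamma z"
  using pochhammer_Gamma[OF not_nonpos_Ints_if_Re_pos[OF assms], of n]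
    not_nonpos_Ints_if_Re_pos[OF assms] by (simp add: Gamma_eq_zero_iff)

lemma pochhammer_neq_0_if_Re_pos:
  fixes z :: complex
  shows "Re z > 0 \<Longrightarrow> pochhammer z n \<noteq> 0"
  by (auto simp: pochhammer_eq_0_iff)

text \<open>The extra powers shift the Beta parameters to \<open>\<gamma> + n\<close> and
  \<open>\<delta> + k\<close>; the resulting Gamma quotients are Pochhammer symbols.\<close>

lemma
  assumes "Re \<gamma> > 0" "Re \<delta> > 0"
  shows integrable_dirichlet_moment: "integrable lborel (\<lambda>u. indicator {0<..<1} u *
      (of_real u ^ n * (1 - of_real u) ^ k * dirichlet_density \<gamma> \<delta> u))" (is "integrable lborel ?f")
    and integral_dirichlet_moment: "(\<integral>u. indicator {0<..<1} u *
      (of_real u ^ n * (1 - of_real u) ^ k * dirichlet_density \<gamma> \<delta> u) \<partial>lborel) =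
      pochhammer \<gamma> n * pochhammer \<delta> k / pochhammer (\<gamma> + \<delta>) (n + k)"
proof -
  define C where "C = Gamma (\<gamma> + \<delta>) / (Gamma \<gamma> * Gamma \<delta>)"
  define \<gamma>' where "\<gamma>' = \<gamma> + of_nat n"
  define \<delta>' where "\<delta>' = \<delta> + of_nat k"
  let ?g = "\<lambda>u. indicator {0<..<1} u *
    (complex_of_real u powr (\<gamma>' - 1) * of_real (1 - u) powr (\<delta>' - 1))"
  have pos: "Re \<gamma>' > 0" "Re \<delta>' > 0"
    using assms by (simp_all add: \<gamma>'_def \<delta>'_def)
  have f_eq: "?f = (\<lambda>u. C * ?g u)"
  proof
    fix u :: real
    show "?f u = C * ?g u"
    proof (cases "u \<in> {0<..<1}")
      case True
      have "of_real v powr (z + of_nat m - 1) = of_real v ^ m * of_real v powr (z - 1)"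
        if "v > 0" for v :: real and z :: complex and m
      proof -
        have "z + of_nat m - 1 = of_nat m + (z - 1)" by simp
        then show ?thesis
          using that by (simp only: powr_add) (simp add: powr_nat')
      qed
      from this[of u \<gamma> n] this[of "1 - u" \<delta> k] True show ?thesis
        by (simp add: dirichlet_density_def C_def \<gamma>'_def \<delta>'_def)
    qed simp
  qed
  show "integrable lborel ?f"
    unfolding f_eq using integrable_Beta_complex[OF pos] by simp
  have "integral\<^sup>L lborel ?f = C * Beta \<gamma>' \<delta>'"
    unfolding f_eq by (simp only: integral_mult_right_zero integral_Beta_complex[OF pos])
  also have "\<dots> = pochhammer \<gamma> n * pochhammer \<delta> k / pochhammer (\<gamma> + \<delta>) (n + k)"
  proof -
    have "\<gamma>' + \<delta>' = (\<gamma> + \<delta>) + of_nat (n + k)"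
      by (simp add: \<gamma>'_def \<delta>'_def)
    then have "Gamma (\<gamma>' + \<delta>') = pochhammer (\<gamma> + \<delta>) (n + k) * Gamma (\<gamma> + \<delta>)"
      using assms by (simp only:) (rule Gamma_plus_of_nat, simp)
    moreover have "Gamma \<gamma> \<noteq> 0" "Gamma \<delta> \<noteq> 0" "Gamma (\<gamma> + \<delta>) \<noteq> 0"
      using assms not_nonpos_Ints_if_Re_pos by (auto simp: Gamma_eq_zero_iff)
    ultimately show ?thesis
      using assms by (simp add: C_def Beta_def \<gamma>'_def \<delta>'_def Gamma_plus_of_nat)
  qed
  finally show "integral\<^sup>L lborel ?f = pochhammer \<gamma> n * pochhammer \<delta> k / pochhammer (\<gamma> + \<delta>) (n + k)" .
qed

section \<open>Absolute convergence of the hypergeometric and binomial series\<close>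

definition hyp2F1_coeff :: "complex \<Rightarrow> complex \<Rightarrow> complex \<Rightarrow> nat \<Rightarrow> complex" where
  "hyp2F1_coeff \<alpha> \<beta> \<gamma> n = pochhammer \<alpha> n * pochhammer \<beta> n / (pochhammer \<gamma> n * fact n)"

lemma hyp2F1_eq_suminf: "hyp2F1 \<alpha> \<beta> \<gamma> z = (\<Sum>n. hyp2F1_coeff \<alpha> \<beta> \<gamma> n * z ^ n)"
  by (simp add: hyp2F1_def hyp2F1_coeff_def)

lemma summable_norm_hyp2F1:
  assumes "Re \<gamma> > 0" "norm z < 1"
  shows "summable (\<lambda>n. norm (hyp2F1_coeff \<alpha> \<beta> \<gamma> n * z ^ n))"
proof -
  \<comment> \<open>The quotient of consecutive coefficients, with every factor divided by
    \<open>Suc n\<close> so that each visibly tends to 1. The ratio test then compares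
    \<open>norm z\<close> with 1.\<close>
  define q where "q n = ((\<alpha> + of_nat n) / of_nat (Suc n)) * ((\<beta> + of_nat n) / of_nat (Suc n)) /
    ((\<gamma> + of_nat n) / of_nat (Suc n))" for n
  have lim: "(\<lambda>n. (s + of_nat n) / of_nat (Suc n)) \<longlonglongrightarrow> 1" for s :: complex
  proof -
    have "(\<lambda>n. 1 + (s - 1) * (1 / of_nat (Suc n))) \<longlonglongrightarrow> 1 + (s - 1) * 0"
      by (intro tendsto_intros LIMSEQ_Suc[OF lim_1_over_n])
    moreover have "1 + (s - 1) * (1 / of_nat (Suc n)) = (s + of_nat n) / of_nat (Suc n)" for n
      by (simp add: field_simps del: of_nat_Suc) simp
    ultimately show ?thesis by simp
  qed
  have "(\<lambda>n. norm (q n * z)) \<longlonglongrightarrow> norm (1 * 1 / 1 * z)"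
    unfolding q_def by (intro tendsto_intros lim) auto
  moreover obtain c where c: "norm z < c" "c < 1"
    using assms(2) dense by blast
  ultimately have "eventually (\<lambda>n. norm (q n * z) < c) sequentially"
    by (intro order_tendstoD) auto
  then obtain N where N: "\<And>n. n \<ge> N \<Longrightarrow> norm (q n * z) < c"
    by (auto simp: eventually_sequentially)
  have step: "hyp2F1_coeff \<alpha> \<beta> \<gamma> (Suc n) * z ^ Suc n = hyp2F1_coeff \<alpha> \<beta> \<gamma> n * z ^ n * (q n * z)" for n
  proof -
    have "\<gamma> + of_nat n \<noteq> 0"
      using assms(1) by (auto simp: complex_eq_iff)
    then show ?thesis
      using pochhammer_neq_0_if_Re_pos[OF assms(1), of n]
      by (simp add: hyp2F1_coeff_def q_def pochhammer_Suc mult_ac del: of_nat_Suc)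
  qed
  show ?thesis
  proof (rule summable_ratio_test[OF c(2)])
    fix n assume "n \<ge> N"
    then have "norm (q n * z) * norm (hyp2F1_coeff \<alpha> \<beta> \<gamma> n * z ^ n) \<le>
        c * norm (hyp2F1_coeff \<alpha> \<beta> \<gamma> n * z ^ n)"
      using N[of n] by (intro mult_right_mono) auto
    then show "norm (norm (hyp2F1_coeff \<alpha> \<beta> \<gamma> (Suc n) * z ^ Suc n)) \<le>
        c * norm (norm (hyp2F1_coeff \<alpha> \<beta> \<gamma> n * z ^ n))"
      unfolding step by (simp add: norm_mult mult_ac)
  qed
qed

lemma has_sum_hyp2F1:
  assumes "Re \<gamma> > 0" "norm z < 1"
  shows "((\<lambda>n. hyp2F1_coeff \<alpha> \<beta> \<gamma> n * z ^ n) has_sum hyp2F1 \<alpha> \<beta> \<gamma> z) UNIV"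
  unfolding hyp2F1_eq_suminf
  by (intro norm_summable_imp_has_sum summable_norm_hyp2F1 summable_sums
      summable_norm_cancel[OF summable_norm_hyp2F1] assms)

text \<open>The triangle inequality, applied factor by factor. It supplies real majorants for series
  with complex parameters.\<close>

lemma norm_pochhammer_le:
  fixes z :: "'a::real_normed_field"
  assumes "norm z \<le> s"
  shows "norm (pochhammer z n) \<le> pochhammer s n"
proof (induction n)
  case (Suc n)
  have "norm (z + of_nat n) \<le> s + of_nat n"
    using norm_triangle_ineq[of z "of_nat n"] assms by simp
  then show ?case
    unfolding pochhammer_Suc norm_mult
    using Suc norm_ge_zero[of "pochhammer z n"] by (intro mult_mono order_trans[OF norm_ge_zero]) auto
qed simp

text \<open>Puts the generalized binomial series into Pochhammer form: the sign
  \<open>(- 1) ^ j\<close> from the binomial coefficient cancels the one from the power.\<close>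

lemma gchoose_minus_mult_power:
  fixes s y :: "'a::field_char_0"
  shows "(- s gchoose j) * (- y) ^ j = pochhammer s j / fact j * y ^ j"
proof -
  have "(- 1) ^ j * (- y) ^ j = y ^ j"
    by (simp flip: power_mult_distrib)
  then show ?thesis
    by (simp add: gbinomial_pochhammer)
qed

lemma sums_binomial_pochhammer_real:
  fixes s y :: real
  assumes "\<bar>y\<bar> < 1"
  shows "(\<lambda>j. pochhammer s j / fact j * y ^ j) sums (1 - y) powr (- s)"
  using gen_binomial_real[of "- y" "- s"] assms
  by (simp add: gchoose_minus_mult_power)

lemma has_sum_binomial_pochhammer:
  fixes s z :: complex
  assumes "norm z < 1"
  shows "((\<lambda>j. pochhammer s j / fact j * z ^ j) has_sum (1 - z) powr (- s)) UNIV"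
proof (rule norm_summable_imp_has_sum)
  show "(\<lambda>j. pochhammer s j / fact j * z ^ j) sums (1 - z) powr (- s)"
    using gen_binomial_complex[of "- z" "- s"] assms
    by (simp add: gchoose_minus_mult_power)
  \<comment> \<open>The binomial series with parameter \<open>norm s\<close> at
    \<open>norm z\<close> is the dominating series.\<close>
  have "summable (\<lambda>j. pochhammer (norm s) j / fact j * norm z ^ j)"
    using sums_binomial_pochhammer_real[of "norm z" "norm s"] assms by (simp add: sums_iff)
  then show "summable (\<lambda>j. norm (pochhammer s j / fact j * z ^ j))"
    by (rule summable_comparison_test'[of _ 0])
       (auto simp: norm_mult norm_divide norm_power intro!: mult_right_mono divide_right_mono
         norm_pochhammer_le)
qed

section \<open>The coefficient identity behind Erdelyi's integral\<close>

text \<open>The left side collects the coefficient of \<open>x ^ N\<close> after termwise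
  integration. The moments cancel the denominators of both coefficients up to a factor
  \<open>pochhammer (\<gamma> + n) j\<close>. Chu-Vandermonde over \<open>k\<close> then merges
  \<open>\<beta> - \<gamma>\<close> with \<open>\<gamma> + n\<close>, and over \<open>n\<close>
  merges \<open>\<alpha>\<close> with \<open>lam\<close>.\<close>

lemma erdelyi_coeff:
  assumes "Re \<gamma> > 0" "Re \<tau> > Re \<gamma>"
  shows "(\<Sum>(n, k, j) | n + k + j = N. hyp2F1_coeff \<alpha> \<beta> \<gamma> n *
      (hyp2F1_coeff lam (\<beta> - \<gamma>) (\<tau> - \<gamma>) k * (pochhammer (lam + of_nat k) j / fact j)) *
      (pochhammer \<gamma> (n + j) * pochhammer (\<tau> - \<gamma>) k / pochhammer \<tau> (n + j + k))) =
    hyp2F1_coeff (\<alpha> + lam) \<beta> \<tau> N" (is "?lhs = _")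
proof -
  have nz: "pochhammer \<gamma> n \<noteq> 0" "pochhammer (\<tau> - \<gamma>) n \<noteq> 0" "pochhammer \<tau> n \<noteq> 0" for n
    using assms by (auto intro!: pochhammer_neq_0_if_Re_pos)
  let ?t = "\<lambda>n k. pochhammer \<alpha> n * pochhammer \<beta> n * pochhammer lam (N - n) /
    (pochhammer \<tau> N * fact n * fact (N - n)) *
    (of_nat ((N - n) choose k) * pochhammer (\<beta> - \<gamma>) k * pochhammer (\<gamma> + of_nat n) (N - n - k))"
  have "?lhs = (\<Sum>(n, k)\<in>(SIGMA n:{..N}. {..N - n}). ?t n k)"
  proof (rule sum.reindex_bij_witness[where i = "\<lambda>(n, k). (n, k, N - n - k)"
        and j = "\<lambda>(n, k, j). (n, k)"], goal_cases)
    case (5 p)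
    then obtain n k j where p: "p = (n, k, j)" and N: "N = n + k + j" by auto
    have "pochhammer lam (k + j) = pochhammer lam k * pochhammer (lam + of_nat k) j"
      "pochhammer \<gamma> (n + j) = pochhammer \<gamma> n * pochhammer (\<gamma> + of_nat n) j"
      by (simp_all add: pochhammer_product')
    moreover have "of_nat ((k + j) choose k) = (fact (k + j) / (fact k * fact j) :: complex)"
      by (simp add: binomial_fact)
    ultimately show ?case
      using nz by (simp add: p N hyp2F1_coeff_def add_ac mult_ac)
  qed auto
  also have "\<dots> = (\<Sum>n\<le>N. \<Sum>k\<le>N - n. ?t n k)"
    by (simp add: sum.Sigma)
  also have "\<dots> = (\<Sum>n\<le>N. pochhammer \<alpha> n * pochhammer \<beta> n * pochhammer lam (N - n) /
    (pochhammer \<tau> N * fact n * fact (N - n)) * pochhammer (\<beta> - \<gamma> + (\<gamma> + of_nat n)) (N - n))"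
    by (simp only: pochhammer_binomial_sum[of "\<beta> - \<gamma>"] sum_distrib_left)
  \<comment> \<open>The first Vandermonde sum produced the parameter \<open>\<beta> + n\<close>,
    which completes \<open>pochhammer \<beta> n\<close> to \<open>pochhammer \<beta> N\<close>. This
    leaves the second Vandermonde sum with a prefactor independent of \<open>n\<close>.\<close>
  also have "\<dots> = (\<Sum>n\<le>N. pochhammer \<beta> N / (pochhammer \<tau> N * fact N) *
      (of_nat (N choose n) * pochhammer \<alpha> n * pochhammer lam (N - n)))"
  proof (rule sum.cong)
    fix n assume "n \<in> {..N}"
    then have "pochhammer \<beta> N = pochhammer \<beta> n * pochhammer (\<beta> + of_nat n) (N - n)"
      and "of_nat (N choose n) = (fact N / (fact n * fact (N - n)) :: complex)"
      by (simp_all add: pochhammer_product binomial_fact)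
    then show "pochhammer \<alpha> n * pochhammer \<beta> n * pochhammer lam (N - n) /
        (pochhammer \<tau> N * fact n * fact (N - n)) * pochhammer (\<beta> - \<gamma> + (\<gamma> + of_nat n)) (N - n) =
      pochhammer \<beta> N / (pochhammer \<tau> N * fact N) *
        (of_nat (N choose n) * pochhammer \<alpha> n * pochhammer lam (N - n))"
      by (simp add: mult_ac)
  qed simp
  also have "\<dots> = hyp2F1_coeff (\<alpha> + lam) \<beta> \<tau> N"
    by (simp add: hyp2F1_coeff_def pochhammer_binomial_sum[of \<alpha>] sum_distrib_left sum_divide_distrib mult_ac)
  finally show ?thesis .
qed

section \<open>Integrals of products with separated variables\<close>

text \<open>Iterated, this reduces a separated integrand on the fourfold product to four integrals
  over the line.\<close>

lemma
  fixes f :: "'a::euclidean_space \<Rightarrow> complex" and g :: "'b::euclidean_space \<Rightarrow> complex"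
  assumes f: "integrable lborel f" and g: "integrable lborel g"
  shows integrable_lborel_mult_pair: "integrable lborel (\<lambda>(x, y). f x * g y)"
    and integral_lborel_mult_pair:
      "(\<integral>p. (case p of (x, y) \<Rightarrow> f x * g y) \<partial>lborel) = integral\<^sup>L lborel f * integral\<^sup>L lborel g"
proof -
  have [measurable]: "f \<in> borel_measurable lborel" "g \<in> borel_measurable lborel"
    using f g by (auto intro: borel_measurable_integrable)
  have int: "integrable (lborel \<Otimes>\<^sub>M lborel) (\<lambda>(x, y). f x * g y)"
    using f g by (intro lborel_pair.Fubini_integrable) (auto simp: norm_mult)
  then show "integrable lborel (\<lambda>(x, y). f x * g y)"
    by (simp add: lborel_prod)
  have "(\<integral>p. (case p of (x, y) \<Rightarrow> f x * g y) \<partial>(lborel \<Otimes>\<^sub>M lborel)) =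
      integral\<^sup>L lborel f * integral\<^sup>L lborel g"
    using lborel_pair.integral_fst'[OF int] by simp
  then show "(\<integral>p. (case p of (x, y) \<Rightarrow> f x * g y) \<partial>lborel) = integral\<^sup>L lborel f * integral\<^sup>L lborel g"
    by (simp add: lborel_prod)
qed

section \<open>Erdelyi's integral\<close>

text \<open>All three follow from
  \<open>(1 - u) * norm x < 1 - u * norm x \<le> norm (1 - u * x)\<close>. They keep the arguments
  of the series inside the unit disc throughout the integration.\<close>

lemma
  fixes u :: real and x :: complex
  assumes "u \<in> {0<..<1}" "norm x < 1"
  shows norm_of_real_mult_less_1: "norm (of_real u * x) < 1"
    and one_minus_of_real_mult_neq_0: "1 - of_real u * x \<noteq> 0"
    and norm_erdelyi_arg_less_1: "norm ((1 - of_real u) * x / (1 - of_real u * x)) < 1"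
proof -
  have "u * norm x \<le> norm x"
    using assms by (simp add: mult_left_le_one_le)
  then have ux: "norm (of_real u * x) = u * norm x" "u * norm x < 1"
    using assms by (auto simp: norm_mult)
  then show "norm (of_real u * x) < 1" by simp
  then show nz: "1 - of_real u * x \<noteq> 0"
    by (metis eq_iff_diff_eq_0 less_irrefl norm_one)
  have "norm (1 - complex_of_real u) = 1 - u"
    using assms by (metis abs_of_pos diff_gt_0_iff_gt greaterThanLessThan_iff norm_of_real of_real_1 of_real_diff)
  then have "norm ((1 - of_real u) * x) = (1 - u) * norm x"
    by (simp add: norm_mult)
  also have "\<dots> < 1 - u * norm x"
    using assms by (simp add: algebra_simps)
  also have "\<dots> \<le> norm (1 - of_real u * x)"
    using norm_triangle_ineq2[of 1 "of_real u * x"] ux by simp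
  finally show "norm ((1 - of_real u) * x / (1 - of_real u * x)) < 1"
    using nz by (simp add: norm_divide divide_less_eq)
qed

text \<open>Expanding both hypergeometric functions and the binomial powers
  \<open>(1 - u x) powr (- lam - k)\<close> turns the integrand into a triple series whose terms integrate to
  Dirichlet moments.\<close>

lemma
  assumes \<gamma>: "Re \<gamma> > 0" and \<tau>: "Re \<tau> > Re \<gamma>" and x: "norm x < 1"
  shows integrable_erdelyi: "integrable lborel (\<lambda>u. indicator {0<..<1} u *
      ((1 - of_real u * x) powr (- lam) * hyp2F1 \<alpha> \<beta> \<gamma> (x * of_real u) *
       hyp2F1 lam (\<beta> - \<gamma>) (\<tau> - \<gamma>) ((1 - of_real u) * x / (1 - of_real u * x)) *
       dirichlet_density \<gamma> (\<tau> - \<gamma>) u))" (is "integrable lborel ?g")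
    and integral_erdelyi: "(\<integral>u. indicator {0<..<1} u *
      ((1 - of_real u * x) powr (- lam) * hyp2F1 \<alpha> \<beta> \<gamma> (x * of_real u) *
       hyp2F1 lam (\<beta> - \<gamma>) (\<tau> - \<gamma>) ((1 - of_real u) * x / (1 - of_real u * x)) *
       dirichlet_density \<gamma> (\<tau> - \<gamma>) u) \<partial>lborel) = hyp2F1 (\<alpha> + lam) \<beta> \<tau> x"
proof -
  define r where "r = norm x"
  have r: "0 \<le> r" "r < 1"
    using x by (auto simp: r_def)
  define cA where "cA = hyp2F1_coeff \<alpha> \<beta> \<gamma>"
  define cB where "cB = hyp2F1_coeff lam (\<beta> - \<gamma>) (\<tau> - \<gamma>)"
  define D where "D = dirichlet_density \<gamma> (\<tau> - \<gamma>)"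
  have \<delta>: "Re (\<tau> - \<gamma>) > 0"
    using \<tau> by simp
  have sumA: "summable (\<lambda>n. norm (cA n) * r ^ n)"
    using summable_norm_hyp2F1[OF \<gamma> x] by (simp add: cA_def norm_mult norm_power r_def)
  have sumB: "summable (\<lambda>n. norm (cB n) * r ^ n)"
    using summable_norm_hyp2F1[OF \<delta> x] by (simp add: cB_def norm_mult norm_power r_def)
  define SA where "SA = (\<Sum>n. norm (cA n) * r ^ n)"
  define SB where "SB = (\<Sum>n. norm (cB n) * r ^ n)"
  define f :: "nat \<times> nat \<times> nat \<Rightarrow> real \<Rightarrow> complex" where
    "f = (\<lambda>(n, k, j) u. indicator {0<..<1} u * (cA n * (x * of_real u) ^ n *
      (cB k * ((1 - of_real u) * x) ^ k *
       (pochhammer (lam + of_nat k) j / fact j * (of_real u * x) ^ j)) * D u))"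
  \<comment> \<open>A constant multiple of the modulus of the density: the triple sum of the
    remaining factors is bounded uniformly in \<open>u\<close>.\<close>
  define w where "w u = SA * (SB * (1 - r) powr (- norm lam)) * norm (indicator {0<..<1} u * D u)" for u
  define c where "c = (\<lambda>(n, k, j). cA n * (cB k * (pochhammer (lam + of_nat k) j / fact j)))"
  have f_eq: "f (n, k, j) = (\<lambda>u. c (n, k, j) * x ^ (n + k + j) * (indicator {0<..<1} u *
      (of_real u ^ (n + j) * (1 - of_real u) ^ k * D u)))" for n k j
    by (auto simp: f_def c_def power_add power_mult_distrib mult_ac)
  have f_int: "integrable lborel (f i)" for i
    by (cases i) (use integrable_dirichlet_moment[OF \<gamma> \<delta>] in \<open>simp add: f_eq D_def\<close>)
  have f_val: "integral\<^sup>L lborel (f (n, k, j)) = c (n, k, j) *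
      (pochhammer \<gamma> (n + j) * pochhammer (\<tau> - \<gamma>) k / pochhammer \<tau> (n + j + k)) * x ^ (n + k + j)" for n k j
    unfolding f_eq D_def integral_mult_right_zero integral_dirichlet_moment[OF \<gamma> \<delta>] by simp
  have w_int: "integrable lborel w"
    using integrable_dirichlet_moment[OF \<gamma> \<delta>, of 0 0] by (simp add: w_def[abs_def] D_def)
  have bound: "(\<Sum>i\<in>F. norm (f i u)) \<le> w u" if "finite F" for F u
  proof (cases "u \<in> {0<..<1}")
    case False
    then have "f i u = 0" for i by (cases i) (simp add: f_def)
    then show ?thesis using False by (simp add: w_def)
  next
    case u: True
    define y where "y = u * r"
    have y: "0 \<le> y" "y < 1" "y \<le> r"
      using u r norm_of_real_mult_less_1[OF u x] by (auto simp: y_def r_def norm_mult mult_left_le_one_le)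
    \<comment> \<open>Majorant of the factor depending on \<open>k\<close> and \<open>j\<close>,
      with \<open>lam\<close> replaced by \<open>norm lam\<close> so that its sum over
      \<open>j\<close> is again a binomial series.\<close>
    define b where "b k j = norm (cB k) * ((1 - u) * r) ^ k * (pochhammer (norm lam + real k) j / fact j * y ^ j)" for k j
    have poch: "pochhammer (norm lam + real k) j \<ge> 0" for k j
      by (rule order_trans[OF norm_ge_zero norm_pochhammer_le[of "norm lam + real k"]]) simp
    have b_nonneg: "b k j \<ge> 0" for k j
      using u r y by (auto simp: b_def intro!: mult_nonneg_nonneg divide_nonneg_nonneg poch)
    have nf: "norm (f (n, k, j) u) \<le> norm (cA n) * r ^ n * b k j * norm (D u)" for n k j
    proof -
      let ?X = "cA n * (x * of_real u) ^ n"
      let ?Y = "cB k * ((1 - of_real u) * x) ^ k *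
        (pochhammer (lam + of_nat k) j / fact j * (of_real u * x) ^ j)"
      have n1: "norm (1 - complex_of_real u) = 1 - u"
        using u by (metis abs_of_pos diff_gt_0_iff_gt greaterThanLessThan_iff norm_of_real of_real_1 of_real_diff)
      have "norm (lam + of_nat k) \<le> norm lam + real k"
        using norm_triangle_ineq[of lam "of_nat k"] by simp
      then have "norm (pochhammer (lam + of_nat k) j) \<le> pochhammer (norm lam + real k) j"
        by (rule norm_pochhammer_le)
      then have "norm ?Y \<le> b k j"
        unfolding b_def using u r y
        by (auto simp: norm_mult norm_divide norm_power n1 y_def r_def
            intro!: mult_left_mono mult_right_mono divide_right_mono)
      moreover have "norm ?X \<le> norm (cA n) * r ^ n"
        using y u r by (auto simp: norm_mult norm_power r_def y_def mult_ac
            intro!: mult_left_mono power_mono)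
      ultimately have "norm ?X * norm ?Y * norm (D u) \<le> norm (cA n) * r ^ n * b k j * norm (D u)"
        using r by (intro mult_right_mono mult_mono) auto
      moreover have "f (n, k, j) u = ?X * ?Y * D u"
        using u by (simp add: f_def)
      ultimately show ?thesis
        by (simp only: norm_mult)
    qed
    have b_sum: "(\<Sum>j\<in>R. b k j) \<le> norm (cB k) * r ^ k * (1 - r) powr (- norm lam)" if "finite R" for R k
    proof -
      have s: "(\<lambda>j. pochhammer (norm lam + real k) j / fact j * y ^ j) sums
          (1 - y) powr (- (norm lam + real k))"
        using y by (intro sums_binomial_pochhammer_real) auto
      have "(\<Sum>j\<in>R. b k j) =
          norm (cB k) * ((1 - u) * r) ^ k * (\<Sum>j\<in>R. pochhammer (norm lam + real k) j / fact j * y ^ j)"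
        by (simp add: b_def sum_distrib_left)
      also have "\<dots> \<le> norm (cB k) * ((1 - u) * r) ^ k * (1 - y) powr (- (norm lam + real k))"
      proof (intro mult_left_mono)
        show "(\<Sum>j\<in>R. pochhammer (norm lam + real k) j / fact j * y ^ j) \<le>
            (1 - y) powr (- (norm lam + real k))"
          unfolding sums_unique[OF s]
          by (intro sum_le_suminf sums_summable[OF s] that mult_nonneg_nonneg divide_nonneg_nonneg
              zero_le_power poch y fact_ge_zero)
      qed (use u r in auto)
      \<comment> \<open>The growth in \<open>k\<close> of the binomial sum is absorbed by
        \<open>((1 - u) * r) ^ k\<close>, because
        \<open>(1 - u) * r / (1 - y) \<le> r\<close>.\<close>
      also have "(1 - y) powr (- (norm lam + real k)) = (1 - y) powr (- norm lam) / (1 - y) ^ k"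
        using y by (simp add: powr_diff powr_realpow)
      also have "norm (cB k) * ((1 - u) * r) ^ k * ((1 - y) powr (- norm lam) / (1 - y) ^ k) =
          norm (cB k) * ((1 - u) * r / (1 - y)) ^ k * (1 - y) powr (- norm lam)"
        by (simp add: power_divide)
      also have "\<dots> \<le> norm (cB k) * r ^ k * (1 - r) powr (- norm lam)"
      proof (intro mult_mono mult_left_mono power_mono)
        have "(1 - u) * r \<le> r * (1 - y)"
        proof -
          have "y * r \<le> y * 1" using y r by (intro mult_left_mono) auto
          then show ?thesis by (simp add: algebra_simps y_def)
        qed
        then show "(1 - u) * r / (1 - y) \<le> r"
          using y by (simp add: divide_le_eq)
        show "(1 - y) powr (- norm lam) \<le> (1 - r) powr (- norm lam)"
          using y r by (intro powr_mono2') auto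
      qed (use u r y in auto)
      finally show ?thesis .
    qed
    define P Q R where "P = fst ` F" and "Q = fst ` snd ` F" and "R = snd ` snd ` F"
    have fin: "finite P" "finite Q" "finite R"
      using that by (auto simp: P_def Q_def R_def)
    have sub: "F \<subseteq> P \<times> Q \<times> R"
      by (auto simp: P_def Q_def R_def image_iff intro: rev_image_eqI)
    have "(\<Sum>i\<in>F. norm (f i u)) \<le> (\<Sum>i\<in>P \<times> Q \<times> R. norm (f i u))"
      using fin sub by (intro sum_mono2) auto
    also have "\<dots> \<le> (\<Sum>(n, k, j)\<in>P \<times> Q \<times> R. norm (cA n) * r ^ n * b k j * norm (D u))"
      using nf by (intro sum_mono) auto
    also have "\<dots> = (\<Sum>n\<in>P. norm (cA n) * r ^ n) * (\<Sum>k\<in>Q. \<Sum>j\<in>R. b k j) * norm (D u)"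
      by (simp add: sum.cartesian_product' sum_distrib_left sum_distrib_right mult_ac)
    also have "\<dots> \<le> SA * (SB * (1 - r) powr (- norm lam)) * norm (D u)"
    proof (intro mult_right_mono mult_mono)
      show "(\<Sum>n\<in>P. norm (cA n) * r ^ n) \<le> SA"
        unfolding SA_def using sumA fin r by (intro sum_le_suminf) auto
      have "(\<Sum>k\<in>Q. \<Sum>j\<in>R. b k j) \<le> (\<Sum>k\<in>Q. norm (cB k) * r ^ k) * (1 - r) powr (- norm lam)"
        unfolding sum_distrib_right using b_sum fin by (intro sum_mono) auto
      also have "\<dots> \<le> SB * (1 - r) powr (- norm lam)"
        unfolding SB_def using sumB fin r by (intro mult_right_mono sum_le_suminf) auto
      finally show "(\<Sum>k\<in>Q. \<Sum>j\<in>R. b k j) \<le> SB * (1 - r) powr (- norm lam)" .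
      show "0 \<le> SA"
        unfolding SA_def using sumA r by (intro suminf_nonneg) auto
    qed (auto intro!: sum_nonneg b_nonneg)
    finally show ?thesis
      using u by (simp add: w_def)
  qed
  have inf: "infinite (UNIV :: (nat \<times> nat \<times> nat) set)"
    by (simp add: finite_prod)
  \<comment> \<open>The series is summed from the inside out: \<open>j\<close> gives the power of
    \<open>1 - u * x\<close>, \<open>k\<close> the second hypergeometric function, \<open>n\<close>
    the first.\<close>
  have pointwise: "(\<Sum>\<^sub>\<infinity>i. f i u) = ?g u" for u
  proof (cases "u \<in> {0<..<1}")
    case False
    then have "f i u = 0" for i by (cases i) (simp add: f_def)
    with False show ?thesis by simp
  next
    case u: True
    let ?v = "1 - of_real u * x" and ?y = "(1 - of_real u) * x / (1 - of_real u * x)"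
    let ?H = "hyp2F1 lam (\<beta> - \<gamma>) (\<tau> - \<gamma>) ?y * ?v powr (- lam)"
    have nz: "?v \<noteq> 0"
      by (rule one_minus_of_real_mult_neq_0[OF u x])
    have "(\<lambda>i. f i u) summable_on UNIV"
      by (rule abs_summable_summable, rule nonneg_bdd_above_summable_on)
         (auto intro!: bdd_aboveI2[where M = "w u"] bound)
    then have summ: "(\<lambda>i. f i u) summable_on (UNIV \<times> (UNIV \<times> UNIV))" by simp
    have j: "((\<lambda>j. f (n, k, j) u) has_sum
        cA n * (x * of_real u) ^ n * (cB k * ?y ^ k * ?v powr (- lam)) * D u) UNIV" for n k
    proof -
      have "((\<lambda>j. pochhammer (lam + of_nat k) j / fact j * (of_real u * x) ^ j) has_sum
          ?v powr (- (lam + of_nat k))) UNIV"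
        by (rule has_sum_binomial_pochhammer[OF norm_of_real_mult_less_1[OF u x]])
      from has_sum_cmult_right[OF this, of "cA n * (x * of_real u) ^ n * (cB k * ((1 - of_real u) * x) ^ k) * D u"]
      have "((\<lambda>j. f (n, k, j) u) has_sum
          cA n * (x * of_real u) ^ n * (cB k * ((1 - of_real u) * x) ^ k) * D u *
          ?v powr (- (lam + of_nat k))) UNIV"
        using u by (simp add: f_def mult_ac)
      \<comment> \<open>The division by \<open>?v ^ k\<close> turns \<open>((1 - u) * x) ^ k\<close>
        into \<open>?y ^ k\<close>.\<close>
      also have "?v powr (- (lam + of_nat k)) = ?v powr (- lam) / ?v ^ k"
        using nz by (simp add: powr_diff powr_nat')
      finally show ?thesis
        by (simp add: power_divide mult_ac)
    qed
    have k: "((\<lambda>p. f (n, p) u) has_sum cA n * (x * of_real u) ^ n * ?H * D u) (UNIV \<times> UNIV)" for n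
    proof (rule has_sum_SigmaI)
      show "((\<lambda>j. f (n, k, j) u) has_sum
          cA n * (x * of_real u) ^ n * (cB k * ?y ^ k * ?v powr (- lam)) * D u) UNIV" for k
        by (rule j)
      show "((\<lambda>k. cA n * (x * of_real u) ^ n * (cB k * ?y ^ k * ?v powr (- lam)) * D u) has_sum
          cA n * (x * of_real u) ^ n * ?H * D u) UNIV"
        unfolding cB_def
        by (intro has_sum_cmult_right has_sum_cmult_left has_sum_hyp2F1 \<delta> norm_erdelyi_arg_less_1 u x)
      show "(\<lambda>p. f (n, p) u) summable_on UNIV \<times> UNIV"
        using summable_on_SigmaD1[of "\<lambda>n p. f (n, p) u" UNIV "\<lambda>_. UNIV \<times> UNIV" n] summ
            by (simp add: case_prod_unfold)
    qed
    have "((\<lambda>i. f i u) has_sum hyp2F1 \<alpha> \<beta> \<gamma> (x * of_real u) * ?H * D u) (UNIV \<times> (UNIV \<times> UNIV))"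
    proof (rule has_sum_SigmaI)
      show "((\<lambda>p. f (n, p) u) has_sum cA n * (x * of_real u) ^ n * ?H * D u) (UNIV \<times> UNIV)" for n
        by (rule k)
      show "((\<lambda>n. cA n * (x * of_real u) ^ n * ?H * D u) has_sum
          hyp2F1 \<alpha> \<beta> \<gamma> (x * of_real u) * ?H * D u) UNIV"
        unfolding cA_def using norm_of_real_mult_less_1[OF u x]
        by (intro has_sum_cmult_left has_sum_hyp2F1 \<gamma>) (simp add: mult.commute)
    qed (rule summ)
    from infsumI[OF this] u show ?thesis
      by (simp add: D_def mult_ac)
  qed
  show "integrable lborel ?g"
    using integrable_infsum[OF inf f_int w_int bound] by (simp only: pointwise)
  have "((\<lambda>i. integral\<^sup>L lborel (f i)) has_sum integral\<^sup>L lborel ?g) UNIV"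
    using has_sum_integral[OF inf f_int w_int bound] by (simp only: pointwise)
  \<comment> \<open>Grouping by the total degree in \<open>x\<close> makes
    \<open>erdelyi_coeff\<close> applicable to each group.\<close>
  then have "((\<lambda>N. \<Sum>i | (\<lambda>(n, k, j). n + k + j) i = N. integral\<^sup>L lborel (f i)) has_sum
      integral\<^sup>L lborel ?g) UNIV"
  proof (rule has_sum_fibers)
    fix N :: nat
    show "finite {i. (\<lambda>(n, k, j). n + k + j) i = N}"
      by (rule finite_subset[of _ "{..N} \<times> {..N} \<times> {..N}"]) auto
  qed
  also have "(\<lambda>N. \<Sum>i | (\<lambda>(n, k, j). n + k + j) i = N. integral\<^sup>L lborel (f i)) =
      (\<lambda>N. hyp2F1_coeff (\<alpha> + lam) \<beta> \<tau> N * x ^ N)"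
  proof
    fix N
    have "(\<Sum>i | (\<lambda>(n, k, j). n + k + j) i = N. integral\<^sup>L lborel (f i)) =
       (\<Sum>(n, k, j) | n + k + j = N. hyp2F1_coeff \<alpha> \<beta> \<gamma> n *
        (hyp2F1_coeff lam (\<beta> - \<gamma>) (\<tau> - \<gamma>) k * (pochhammer (lam + of_nat k) j / fact j)) *
        (pochhammer \<gamma> (n + j) * pochhammer (\<tau> - \<gamma>) k / pochhammer \<tau> (n + j + k))) * x ^ N"
      unfolding sum_distrib_right
      by (rule sum.cong) (auto simp: f_val c_def cA_def cB_def case_prod_unfold)
    then show "(\<Sum>i | (\<lambda>(n, k, j). n + k + j) i = N. integral\<^sup>L lborel (f i)) =
        hyp2F1_coeff (\<alpha> + lam) \<beta> \<tau> N * x ^ N"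
      by (simp only: erdelyi_coeff[OF \<gamma> \<tau>])
  qed
  finally show "integral\<^sup>L lborel ?g = hyp2F1 (\<alpha> + lam) \<beta> \<tau> x"
    using has_sum_hyp2F1[of \<tau> x "\<alpha> + lam" \<beta>] \<gamma> \<tau> x has_sum_unique by auto
qed

section \<open>The convolution and the fourfold integral\<close>

text \<open>Given the totals, the indices of \<open>b\<close> determine those of \<open>a\<close>.
  The convolution thus takes the form that \<open>has_sum_fibers\<close> produces for addition of
  index pairs.\<close>

lemma dconv_eq_sum_fiber:
  "(a \<star> b) m n = (\<Sum>((k, l), (i, j)) | (k + i, l + j) = (m, n). a k l * b i j)"
proof -
  have "(a \<star> b) m n = (\<Sum>(i, j)\<in>{0..m} \<times> {0..n}. a (m - i) (n - j) * b i j)"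
    by (simp add: dconv_def sum.cartesian_product)
  also have "\<dots> = (\<Sum>((k, l), (i, j)) | (k + i, l + j) = (m, n). a k l * b i j)"
    by (rule sum.reindex_bij_witness[where i = snd and j = "\<lambda>(i, j). ((m - i, n - j), (i, j))"]) auto
  finally show ?thesis .
qed

text \<open>\<open>conv_a\<close> and \<open>conv_b\<close> allow the two double series to be
  multiplied at each point of the cube; \<open>abs_conv\<close> provides the integrable majorant for
  exchanging the fourfold sum with the integral. Convergence of the series for \<open>c\<close> is a
  conclusion.\<close>

theorem theorem3p4:
  fixes a b c :: "nat \<Rightarrow> nat \<Rightarrow> complex"
    and \<alpha>1 \<alpha>2 \<beta>1 \<beta>2 \<gamma>1 \<gamma>2 \<gamma>3 \<gamma>4 \<tau>1 \<tau>2 \<tau>3 \<tau>4 lam1 lam2 x1 x2 x3 x4 :: complex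
  assumes "Re \<tau>1 > Re \<gamma>1" "Re \<gamma>1 > 0"
    and "Re \<tau>2 > Re \<gamma>2" "Re \<gamma>2 > 0"
    and "Re \<tau>3 > Re \<gamma>3" "Re \<gamma>3 > 0"
    and "Re \<tau>4 > Re \<gamma>4" "Re \<gamma>4 > 0"
    and "norm x1 < 1" "norm x2 < 1"
    and conv_a: "\<And>u1 u2 u3 u4. (u1, u2, u3, u4) \<in> unit_cube4 \<Longrightarrow>
      F_conv a \<alpha>1 \<beta>1 \<alpha>2 \<beta>2 \<gamma>1 \<gamma>2 (x1 * of_real u1) (x2 * of_real u2) (x3 * of_real u3) (x4 * of_real u4)"
    and conv_b: "\<And>u1 u2 u3 u4. (u1, u2, u3, u4) \<in> unit_cube4 \<Longrightarrow>
      F_conv b lam1 (\<beta>1 - \<gamma>1) lam2 (\<beta>2 - \<gamma>2) (\<tau>1 - \<gamma>1) (\<tau>2 - \<gamma>2)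
        ((1 - of_real u1) * x1 / (1 - of_real u1 * x1)) ((1 - of_real u2) * x2 / (1 - of_real u2 * x2))
        (of_real u3 * x3 / (1 - of_real u1 * x1)) (of_real u4 * x4 / (1 - of_real u2 * x2))"
    and abs_conv: "set_integrable lborel unit_cube4 (\<lambda>(u1, u2, u3, u4).
      norm ((1 - of_real u1 * x1) powr (- lam1) * (1 - of_real u2 * x2) powr (- lam2))
      * F_abs a \<alpha>1 \<beta>1 \<alpha>2 \<beta>2 \<gamma>1 \<gamma>2 (x1 * of_real u1) (x2 * of_real u2) (x3 * of_real u3) (x4 * of_real u4)
      * F_abs b lam1 (\<beta>1 - \<gamma>1) lam2 (\<beta>2 - \<gamma>2) (\<tau>1 - \<gamma>1) (\<tau>2 - \<gamma>2)
          ((1 - of_real u1) * x1 / (1 - of_real u1 * x1)) ((1 - of_real u2) * x2 / (1 - of_real u2 * x2))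
          (of_real u3 * x3 / (1 - of_real u1 * x1)) (of_real u4 * x4 / (1 - of_real u2 * x2))
      * norm (dirichlet_density \<gamma>1 (\<tau>1 - \<gamma>1) u1 * dirichlet_density \<gamma>2 (\<tau>2 - \<gamma>2) u2
            * dirichlet_density \<gamma>3 (\<tau>3 - \<gamma>3) u3 * dirichlet_density \<gamma>4 (\<tau>4 - \<gamma>4) u4))"
    and c_eq: "\<And>m n. c m n = pochhammer \<gamma>3 m / pochhammer \<tau>3 m * (pochhammer \<gamma>4 n / pochhammer \<tau>4 n)
      * (a \<star> b) m n"
  shows "F_conv c (\<alpha>1 + lam1) \<beta>1 (\<alpha>2 + lam2) \<beta>2 \<tau>1 \<tau>2 x1 x2 x3 x4 \<and>
    F_sum c (\<alpha>1 + lam1) \<beta>1 (\<alpha>2 + lam2) \<beta>2 \<tau>1 \<tau>2 x1 x2 x3 x4 =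
    (LINT (u1, u2, u3, u4) : unit_cube4 | lborel.
      (1 - of_real u1 * x1) powr (- lam1) * (1 - of_real u2 * x2) powr (- lam2)
      * F_sum a \<alpha>1 \<beta>1 \<alpha>2 \<beta>2 \<gamma>1 \<gamma>2 (x1 * of_real u1) (x2 * of_real u2) (x3 * of_real u3) (x4 * of_real u4)
      * F_sum b lam1 (\<beta>1 - \<gamma>1) lam2 (\<beta>2 - \<gamma>2) (\<tau>1 - \<gamma>1) (\<tau>2 - \<gamma>2)
          ((1 - of_real u1) * x1 / (1 - of_real u1 * x1)) ((1 - of_real u2) * x2 / (1 - of_real u2 * x2))
          (of_real u3 * x3 / (1 - of_real u1 * x1)) (of_real u4 * x4 / (1 - of_real u2 * x2))
      * (dirichlet_density \<gamma>1 (\<tau>1 - \<gamma>1) u1 * dirichlet_density \<gamma>2 (\<tau>2 - \<gamma>2) u2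
       * dirichlet_density \<gamma>3 (\<tau>3 - \<gamma>3) u3 * dirichlet_density \<gamma>4 (\<tau>4 - \<gamma>4) u4))"
proof -
  let ?I = "indicator {0<..<1} :: real \<Rightarrow> complex"
  let ?D1 = "dirichlet_density \<gamma>1 (\<tau>1 - \<gamma>1)" and ?D2 = "dirichlet_density \<gamma>2 (\<tau>2 - \<gamma>2)"
  let ?D3 = "dirichlet_density \<gamma>3 (\<tau>3 - \<gamma>3)" and ?D4 = "dirichlet_density \<gamma>4 (\<tau>4 - \<gamma>4)"
  let ?y1 = "\<lambda>u. (1 - of_real u) * x1 / (1 - of_real u * x1)"
  let ?y2 = "\<lambda>u. (1 - of_real u) * x2 / (1 - of_real u * x2)"
  define A where "A = (\<lambda>(u1, u2, u3, u4). F_term a \<alpha>1 \<beta>1 \<alpha>2 \<beta>2 \<gamma>1 \<gamma>2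
    (x1 * of_real u1) (x2 * of_real u2) (x3 * of_real u3) (x4 * of_real u4))"
  define B where "B = (\<lambda>(u1, u2, u3, u4). F_term b lam1 (\<beta>1 - \<gamma>1) lam2 (\<beta>2 - \<gamma>2) (\<tau>1 - \<gamma>1) (\<tau>2 - \<gamma>2)
    (?y1 u1) (?y2 u2) (of_real u3 * x3 / (1 - of_real u1 * x1))
        (of_real u4 * x4 / (1 - of_real u2 * x2)))"
  define P where "P = (\<lambda>(u1, u2, u3 :: real, u4 :: real).
      (1 - of_real u1 * x1) powr (- lam1) * (1 - of_real u2 * x2) powr (- lam2))"
  define D where "D = (\<lambda>(u1, u2, u3, u4). ?D1 u1 * ?D2 u2 * ?D3 u3 * ?D4 u4)"
  \<comment> \<open>The exponent contains \<open>i\<close> because the third argument of the series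
    for \<open>b\<close> contributes \<open>(1 - u1 * x1) ^ i\<close> in the denominator. This makes
    \<open>g1\<close> an Erdelyi integrand for \<open>\<alpha>1 + k\<close> and
    \<open>lam1 + i\<close>.\<close>
  define g1 where "g1 k i u = ?I u * ((1 - of_real u * x1) powr (- (lam1 + of_nat i)) *
    hyp2F1 (\<alpha>1 + of_nat k) \<beta>1 \<gamma>1 (x1 * of_real u) *
    hyp2F1 (lam1 + of_nat i) (\<beta>1 - \<gamma>1) (\<tau>1 - \<gamma>1) (?y1 u) * ?D1 u)" for k i :: nat and u :: real
  define g2 where "g2 k i u = ?I u * ((1 - of_real u * x2) powr (- (lam2 + of_nat i)) *
    hyp2F1 (\<alpha>2 + of_nat k) \<beta>2 \<gamma>2 (x2 * of_real u) *
    hyp2F1 (lam2 + of_nat i) (\<beta>2 - \<gamma>2) (\<tau>2 - \<gamma>2) (?y2 u) * ?D2 u)" for k i :: nat and u :: real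
  \<comment> \<open>The trivial power with exponent 0 matches the form of the Dirichlet
    moments.\<close>
  define g3 where "g3 m u = ?I u * (of_real u ^ m * (1 - of_real u) ^ 0 * ?D3 u)" for m :: nat and u :: real
  define g4 where "g4 m u = ?I u * (of_real u ^ m * (1 - of_real u) ^ 0 * ?D4 u)" for m :: nat and u :: real
  \<comment> \<open>The nested case distinctions follow the nesting of the product type, so the pair
    lemma applies three times.\<close>
  define T where "T = (\<lambda>((k, l), (i, j)) u. a k l * b i j * x3 ^ (k + i) * x4 ^ (l + j) *
    (case u of (u1, v) \<Rightarrow> g1 k i u1 * (case v of (u2, v) \<Rightarrow> g2 l j u2 *
      (case v of (u3, u4) \<Rightarrow> g3 (k + i) u3 * g4 (l + j) u4))))"
  define w where "w u = indicator unit_cube4 u *\<^sub>R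
    (norm (P u) * infsum (\<lambda>p. norm (A u p)) UNIV * infsum (\<lambda>p. norm (B u p)) UNIV * norm (D u))" for u
  \<comment> \<open>The part of the integrated term that depends on the total indices alone.\<close>
  define G where "G m n = pochhammer \<gamma>3 m / pochhammer \<tau>3 m * (pochhammer \<gamma>4 n / pochhammer \<tau>4 n) *
    hyp2F1 (\<alpha>1 + lam1 + of_nat m) \<beta>1 \<tau>1 x1 * hyp2F1 (\<alpha>2 + lam2 + of_nat n) \<beta>2 \<tau>2 x2 *
    x3 ^ m * x4 ^ n" for m n

  have g1: "integrable lborel (g1 k i)"
    "integral\<^sup>L lborel (g1 k i) = hyp2F1 (\<alpha>1 + lam1 + of_nat (k + i)) \<beta>1 \<tau>1 x1" for k i
    using integrable_erdelyi[of \<gamma>1 \<tau>1 x1 "lam1 + of_nat i" "\<alpha>1 + of_nat k" \<beta>1]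
      integral_erdelyi[of \<gamma>1 \<tau>1 x1 "lam1 + of_nat i" "\<alpha>1 + of_nat k" \<beta>1] assms(1-10)
    unfolding g1_def[abs_def] by (simp_all only: of_nat_add add_ac)
  have g2: "integrable lborel (g2 k i)"
    "integral\<^sup>L lborel (g2 k i) = hyp2F1 (\<alpha>2 + lam2 + of_nat (k + i)) \<beta>2 \<tau>2 x2" for k i
    using integrable_erdelyi[of \<gamma>2 \<tau>2 x2 "lam2 + of_nat i" "\<alpha>2 + of_nat k" \<beta>2]
      integral_erdelyi[of \<gamma>2 \<tau>2 x2 "lam2 + of_nat i" "\<alpha>2 + of_nat k" \<beta>2] assms(1-10)
    unfolding g2_def[abs_def] by (simp_all only: of_nat_add add_ac)
  have g3: "integrable lborel (g3 m)" "integral\<^sup>L lborel (g3 m) = pochhammer \<gamma>3 m / pochhammer \<tau>3 m" for m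
    using integrable_dirichlet_moment[of \<gamma>3 "\<tau>3 - \<gamma>3" m 0] integral_dirichlet_moment[of \<gamma>3 "\<tau>3 - \<gamma>3" m 0]
      assms(5,6) by (simp_all add: g3_def[abs_def])
  have g4: "integrable lborel (g4 m)" "integral\<^sup>L lborel (g4 m) = pochhammer \<gamma>4 m / pochhammer \<tau>4 m" for m
    using integrable_dirichlet_moment[of \<gamma>4 "\<tau>4 - \<gamma>4" m 0] integral_dirichlet_moment[of \<gamma>4 "\<tau>4 - \<gamma>4" m 0]
      assms(7,8) by (simp_all add: g4_def[abs_def])
  have T_int: "integrable lborel (T p)" for p
    unfolding T_def
    by (cases p, cases "fst p", cases "snd p")
       (simp add: integrable_lborel_mult_pair g1 g2 g3 g4)
  have T_val: "integral\<^sup>L lborel (T ((k, l), (i, j))) = G (k + i) (l + j) * (a k l * b i j)" for k l i j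
    unfolding T_def
    by (simp add: integral_lborel_mult_pair integrable_lborel_mult_pair g1 g2 g3 g4 G_def mult_ac
        del: of_nat_add)
  have T_cube: "T (p, q) u = P u * D u * (A u p * B u q)" if "u \<in> unit_cube4" for p q u
  proof -
    obtain k l i j u1 u2 u3 u4 where eq: "p = (k, l)" "q = (i, j)" "u = (u1, u2, u3, u4)"
      by (metis surj_pair)
    have u: "u1 \<in> {0<..<1}" "u2 \<in> {0<..<1}" "u3 \<in> {0<..<1}" "u4 \<in> {0<..<1}"
      using that by (auto simp: eq unit_cube4_def)
    have "(1 - of_real u1 * x1) powr (- (lam1 + of_nat i)) =
        (1 - of_real u1 * x1) powr (- lam1) / (1 - of_real u1 * x1) ^ i"
      using one_minus_of_real_mult_neq_0[OF u(1) assms(9)] by (simp add: powr_diff powr_nat')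
    moreover have "(1 - of_real u2 * x2) powr (- (lam2 + of_nat j)) =
        (1 - of_real u2 * x2) powr (- lam2) / (1 - of_real u2 * x2) ^ j"
      using one_minus_of_real_mult_neq_0[OF u(2) assms(10)] by (simp add: powr_diff powr_nat')
    ultimately show ?thesis
      using u unfolding eq T_def A_def B_def P_def D_def g1_def g2_def g3_def g4_def F_term_def
      by (simp only: prod.case indicator_simps)
         (simp add: power_add power_mult_distrib power_divide mult_ac)
  qed
  have T_out: "T p u = 0" if "u \<notin> unit_cube4" for p u
    using that by (cases p; cases u)
      (auto simp: T_def g1_def g2_def g3_def g4_def unit_cube4_def indicator_def)
  have summA: "(\<lambda>p. norm (A u p)) summable_on UNIV" and summB: "(\<lambda>p. norm (B u p)) summable_on UNIV"
    if "u \<in> unit_cube4" for u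
    using that conv_a conv_b by (cases u; force simp: A_def B_def F_conv_def)+
  have w_int: "integrable lborel w"
    using abs_conv unfolding set_integrable_def w_def[abs_def] P_def A_def B_def D_def F_abs_def
    by (simp only: case_prod_unfold)
  \<comment> \<open>On the cube, a finite sum of products of norms is at most the product of the two
    full sums, which is the integrand of \<open>abs_conv\<close>.\<close>
  have bound: "(\<Sum>p\<in>F. norm (T p u)) \<le> w u" if "finite F" for F u
  proof (cases "u \<in> unit_cube4")
    case True
    have "((\<lambda>(p, q). norm (A u p) * norm (B u q)) has_sum
        infsum (\<lambda>p. norm (A u p)) UNIV * infsum (\<lambda>q. norm (B u q)) UNIV) (UNIV \<times> UNIV)"
      using summA[OF True] summB[OF True] by (intro has_sum_mult_Times) auto
    then have "(\<Sum>(p, q)\<in>F. norm (A u p) * norm (B u q)) \<le>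
        infsum (\<lambda>p. norm (A u p)) UNIV * infsum (\<lambda>q. norm (B u q)) UNIV"
      by (rule finite_sum_le_has_sum) (use that in auto)
    then have "norm (P u) * norm (D u) * (\<Sum>(p, q)\<in>F. norm (A u p) * norm (B u q)) \<le>
        norm (P u) * norm (D u) * (infsum (\<lambda>p. norm (A u p)) UNIV * infsum (\<lambda>q. norm (B u q)) UNIV)"
      by (intro mult_left_mono) auto
    moreover have "(\<Sum>p\<in>F. norm (T p u)) =
        norm (P u) * norm (D u) * (\<Sum>(p, q)\<in>F. norm (A u p) * norm (B u q))"
      unfolding sum_distrib_left by (rule sum.cong) (auto simp: T_cube[OF True] norm_mult)
    ultimately show ?thesis
      using True by (simp add: w_def mult_ac)
  qed (simp add: T_out w_def)
  have inf: "infinite (UNIV :: ((nat \<times> nat) \<times> (nat \<times> nat)) set)"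
    by (simp add: finite_prod)
  have pointwise: "(\<Sum>\<^sub>\<infinity>p. T p u) = indicator unit_cube4 u *\<^sub>R
      (P u * infsum (A u) UNIV * infsum (B u) UNIV * D u)" for u
  proof (cases "u \<in> unit_cube4")
    case True
    have "((\<lambda>(p, q). A u p * B u q) has_sum (infsum (A u) UNIV * infsum (B u) UNIV)) (UNIV \<times> UNIV)"
      using summA[OF True] summB[OF True] by (rule has_sum_mult_Times)
    from has_sum_cmult_right[OF this, of "P u * D u"]
    have "((\<lambda>p. T p u) has_sum P u * D u * (infsum (A u) UNIV * infsum (B u) UNIV)) UNIV"
      by (simp add: case_prod_unfold T_cube[OF True, of "fst p" "snd p" for p, simplified])
    from infsumI[OF this] True show ?thesis
      by (simp add: mult_ac)
  qed (simp add: T_out)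
  let ?h = "\<lambda>((k, l), (i, j)). (k + i, l + j) :: nat \<times> nat"
  have fin: "finite {p. ?h p = y}" for y
    by (rule finite_subset[of _ "({..fst y} \<times> {..snd y}) \<times> ({..fst y} \<times> {..snd y})"]) auto
  have fiber: "(\<Sum>p | ?h p = y. integral\<^sup>L lborel (T p)) =
      F_term c (\<alpha>1 + lam1) \<beta>1 (\<alpha>2 + lam2) \<beta>2 \<tau>1 \<tau>2 x1 x2 x3 x4 y" for y
  proof -
    obtain m n where y: "y = (m, n)" by fastforce
    \<comment> \<open>\<open>G\<close> is constant on the fiber and factors out, leaving the
      convolution sum.\<close>
    have "(\<Sum>p | ?h p = y. integral\<^sup>L lborel (T p)) =
        G m n * (\<Sum>((k, l), (i, j)) | (k + i, l + j) = (m, n). a k l * b i j)"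
      unfolding sum_distrib_left y
      by (rule sum.cong) (auto simp: T_val case_prod_unfold)
    also have "\<dots> = F_term c (\<alpha>1 + lam1) \<beta>1 (\<alpha>2 + lam2) \<beta>2 \<tau>1 \<tau>2 x1 x2 x3 x4 y"
      unfolding dconv_eq_sum_fiber[symmetric] by (simp add: y F_term_def c_eq G_def mult_ac)
    finally show ?thesis .
  qed
  \<comment> \<open>Convergence for \<open>c\<close> descends from here by two triangle
    inequalities: one for the integral, one for the finite sum over a fiber.\<close>
  have "(\<lambda>p. \<integral>u. norm (T p u) \<partial>lborel) summable_on UNIV"
    by (rule summable_on_integral_norm[OF inf T_int w_int bound])
  then have "(\<lambda>p. norm (integral\<^sup>L lborel (T p))) summable_on UNIV"
    by (rule Infinite_Sum.abs_summable_on_comparison_test') (rule integral_norm_bound)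
  from has_sum_fibers[OF has_sum_infsum[OF this] fin]
  have "(\<lambda>y. \<Sum>p | ?h p = y. norm (integral\<^sup>L lborel (T p))) summable_on UNIV"
    by (rule has_sum_imp_summable)
  then have conv: "F_conv c (\<alpha>1 + lam1) \<beta>1 (\<alpha>2 + lam2) \<beta>2 \<tau>1 \<tau>2 x1 x2 x3 x4"
    unfolding F_conv_def fiber[symmetric]
    by (rule Infinite_Sum.abs_summable_on_comparison_test') (rule norm_sum)
  have "((\<lambda>p. integral\<^sup>L lborel (T p)) has_sum (\<integral>u. (\<Sum>\<^sub>\<infinity>p. T p u) \<partial>lborel)) UNIV"
    by (rule has_sum_integral[OF inf T_int w_int bound])
  from has_sum_fibers[OF this fin]
  have "F_sum c (\<alpha>1 + lam1) \<beta>1 (\<alpha>2 + lam2) \<beta>2 \<tau>1 \<tau>2 x1 x2 x3 x4 = (\<integral>u. (\<Sum>\<^sub>\<infinity>p. T p u) \<partial>lborel)"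
    unfolding fiber F_sum_def by (rule infsumI)
  with conv show ?thesis
    unfolding pointwise set_lebesgue_integral_def F_sum_def P_def A_def B_def D_def
    by (simp only: case_prod_unfold simp_thms)
qed

end
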